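(* The following equalities hold: $\varphi((S_1\square S_3)^3)=8$, $\varphi((S_2\square S_3)^3)=9$, $\varphi((S_3\square S_3)^3)=10$, $\varphi((S_4\square S_3)^3)=13$, $\varphi((S_5\square S_3)^3)=15$, and for every integer $n\ge 6$, $\varphi((S_n\square S_3)^3)=2n+4$.
   Context: All graphs are finite, simple, undirected and connected. The star graph $S_n$ has $n+1$ vertices: a central vertex adjacent to each of $n$ other vertices, and no two of these $n$ vertices are adjacent (so $S_n=K_{1,n}$). The Cartesian product $G\square H$ has vertex set $V(G)\times V(H)$, with $(u,v)$ and $(u',v')$ adjacent if and only if either $v=v'$ and $u\sim u'$ in $G$, or $u=u'$ and $v\sim v'$ in $H$. For a positive integer $p$, the power graph $G^p$ has vertex set $V(G)$, with two distinct vertices adjacent if and only if their distance in $G$ is at most $p$. In a proper coloring of $G$ with $k$ colors, a vertex of color $i$ is a $b$-vertex if for each color $j\ne i$ it is adjacent to at least one vertex of color $j$; a proper coloring is a $b$-coloring if every one of its colors $i\in\{1,\dots,k\}$ has at least one $b$-vertex of color $i$. The $b$-chromatic number $\varphi(G)$ is the largest integer $k$ such that $G$ has a $b$-coloring with $k$ colors. *)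

theory Defs
  imports "Graph_Theory.Pair_Digraph" "Graph_Theory.Shortest_Path"
begin

text \<open>
  Finite simple undirected graphs are represented as in the AFP entry Graph_Theory, by the locale
  \<^locale>\<open>pair_graph\<close>: finite loop-free digraphs without parallel arcs whose arc relation is
  symmetric, so that an edge \<open>{u, v}\<close> is the pair of arcs \<open>(u, v)\<close>, \<open>(v, u)\<close>.
\<close>

text \<open>The centre is \<open>0\<close>, and the \<open>n\<close> leaves are \<open>1, \<dots>, n\<close>.\<close>

definition star_graph :: "nat \<Rightarrow> nat pair_pre_digraph" where
  "star_graph n =
     \<lparr> pverts = {0..n},
       parcs = {(u, v). (u = 0 \<and> v \<in> {1..n}) \<or> (u \<in> {1..n} \<and> v = 0)} \<rparr>"

definition cartesian_product ::
  "'a pair_pre_digraph \<Rightarrow> 'b pair_pre_digraph \<Rightarrow> ('a \<times> 'b) pair_pre_digraph"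
  (infixl \<open>\<box>\<close> 70) where
  "G \<box> H =
     \<lparr> pverts = pverts G \<times> pverts H,
       parcs = {((u, v), (u', v')).
          u \<in> pverts G \<and> u' \<in> pverts G \<and> v \<in> pverts H \<and> v' \<in> pverts H \<and>
          ((v = v' \<and> (u, u') \<in> parcs G) \<or> (u = u' \<and> (v, v') \<in> parcs H))} \<rparr>"

text \<open>
  The library's shortest-path cost for the constant weight \<open>1\<close>, i.e. the infimum of the lengths
  of the walks from \<open>u\<close> to \<open>v\<close>; it is \<open>\<infinity>\<close> if there is no such walk.
\<close>

definition graph_dist :: "'a pair_pre_digraph \<Rightarrow> 'a \<Rightarrow> 'a \<Rightarrow> ereal" where
  "graph_dist G u v = wf_digraph.\<mu> (with_proj G) (\<lambda>_. 1) u v"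

definition power_graph :: "'a pair_pre_digraph \<Rightarrow> nat \<Rightarrow> 'a pair_pre_digraph" where
  "power_graph G p =
     \<lparr> pverts = pverts G,
       parcs = {(u, v). u \<in> pverts G \<and> v \<in> pverts G \<and> u \<noteq> v \<and>
                        graph_dist G u v \<le> ereal (real p)} \<rparr>"

definition proper_coloring :: "'a pair_pre_digraph \<Rightarrow> nat \<Rightarrow> ('a \<Rightarrow> nat) \<Rightarrow> bool" where
  "proper_coloring G k c \<longleftrightarrow>
     (\<forall>v \<in> pverts G. c v \<in> {1..k}) \<and> (\<forall>(u, v) \<in> parcs G. c u \<noteq> c v)"

definition b_vertex :: "'a pair_pre_digraph \<Rightarrow> nat \<Rightarrow> ('a \<Rightarrow> nat) \<Rightarrow> 'a \<Rightarrow> bool" where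
  "b_vertex G k c v \<longleftrightarrow>
     v \<in> pverts G \<and> (\<forall>j \<in> {1..k}. j \<noteq> c v \<longrightarrow> (\<exists>w \<in> pverts G. (v, w) \<in> parcs G \<and> c w = j))"

definition b_coloring :: "'a pair_pre_digraph \<Rightarrow> nat \<Rightarrow> ('a \<Rightarrow> nat) \<Rightarrow> bool" where
  "b_coloring G k c \<longleftrightarrow>
     proper_coloring G k c \<and> (\<forall>i \<in> {1..k}. \<exists>v \<in> pverts G. c v = i \<and> b_vertex G k c v)"

definition b_chromatic_number :: "'a pair_pre_digraph \<Rightarrow> nat" (\<open>\<phi>\<close>) where
  "\<phi> G = (GREATEST k. \<exists>c. b_coloring G k c)"

text \<open>In a b-colouring of a finite graph every colour is used, so the set of admissible \<open>k\<close> is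
  bounded and the \<open>GREATEST\<close> above ranges over a finite set.\<close>

lemma b_coloring_le_card:
  assumes "finite (pverts G)" "b_coloring G k c"
  shows "k \<le> card (pverts G)"
proof -
  have "{1..k} \<subseteq> c ` pverts G"
    using assms(2) by (force simp: b_coloring_def)
  then have "card {1..k} \<le> card (c ` pverts G)"
    using assms(1) by (intro card_mono) auto
  also have "\<dots> \<le> card (pverts G)"
    using assms(1) by (rule card_image_le)
  finally show ?thesis by simp
qed

lemma pair_graph_star_graph: "pair_graph (star_graph n)"
proof -
  have "finite (parcs (star_graph n))"
    by (rule finite_subset[of _ "{0..n} \<times> {0..n}"]) (auto simp: star_graph_def)
  then show ?thesis
    by unfold_locales (auto simp: star_graph_def symmetric_def sym_def)
qed

lemma pair_graph_cartesian_product: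
  assumes "pair_graph G" "pair_graph H"
  shows "pair_graph (G \<box> H)"
proof -
  interpret G: pair_graph G by fact
  interpret H: pair_graph H by fact
  have "finite (parcs (G \<box> H))"
    by (rule finite_subset[of _ "(pverts G \<times> pverts H) \<times> (pverts G \<times> pverts H)"])
       (auto simp: cartesian_product_def G.pair_finite_verts H.pair_finite_verts)
  then show ?thesis
    by unfold_locales
       (auto simp: cartesian_product_def symmetric_def sym_def G.pair_finite_verts
          H.pair_finite_verts dest: G.arcs_symmetric H.arcs_symmetric G.no_loops' H.no_loops')
qed

end

theory Submission
  imports Defs
begin

text \<open>
  Two vertices of the product of two stars are at distance more than \<open>3\<close> only if they differ in both
  coordinates and all four coordinates are leaves. So in the third power the \<open>n + 4\<close> vertices with a
  central coordinate are universal, each of them takes a colour of its own, and the remaining vertices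
  induce the rook graph of a \<open>3 \<times> n\<close> table; its b-chromatic number \<open>m\<close> gives the value \<open>m + n + 4\<close>.

  If the table uses more than \<open>n\<close> colours, every row misses some colour, and a b-cell of the row must
  have this colour in its column. Hence each row has at most two b-cells and there are at most \<open>6\<close>
  colours, so for \<open>n \<ge> 6\<close> cyclic shifts are optimal. By the degree bound at most \<open>n + 2\<close> colours
  occur, and \<open>n + 2\<close> is impossible for \<open>n \<ge> 2\<close>, since then two b-cells of one row exclude further
  b-cells from their columns. Only four colours on the \<open>3 \<times> 3\<close> table need a case analysis.
\<close>

section \<open>Distances as lengths of walks\<close>

lemma awalk_imp_relpow:
  assumes "pair_wf_digraph G" "pre_digraph.awalk (with_proj G) u p v"
  shows "(u, v) \<in> parcs G ^^ length p"
proof -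
  interpret pair_wf_digraph G by fact
  show ?thesis
    using assms(2)
  proof (induction p arbitrary: u)
    case Nil
    then show ?case by (simp add: awalk_Nil_iff)
  next
    case (Cons e p)
    then have "(fst e, snd e) \<in> parcs G" "fst e = u" "awalk (snd e) p v"
      by (auto simp: awalk_Cons_iff)
    with Cons.IH[of "snd e"] show ?case
      by (auto simp del: relpow.simps intro: relpow_Suc_I2)
  qed
qed

lemma relpow_imp_awalk:
  assumes "pair_wf_digraph G" "u \<in> pverts G" "(u, v) \<in> parcs G ^^ k"
  shows "\<exists>p. pre_digraph.awalk (with_proj G) u p v \<and> length p = k"
proof -
  interpret pair_wf_digraph G by fact
  show ?thesis
    using assms(2,3)
  proof (induction k arbitrary: u)
    case 0
    then show ?case by (auto simp: awalk_Nil_iff)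
  next
    case (Suc k)
    from Suc.prems(2) obtain w where w: "(u, w) \<in> parcs G" "(w, v) \<in> parcs G ^^ k"
      by (blast elim: relpow_Suc_E2)
    then have "w \<in> pverts G" using in_arcsD2 by blast
    from Suc.IH[OF this w(2)] obtain p where "awalk w p v" "length p = k" by auto
    with w(1) have "awalk u ((u, w) # p) v \<and> length ((u, w) # p) = Suc k"
      by (simp add: awalk_Cons_iff)
    then show ?case by blast
  qed
qed

lemma graph_dist_le_iff:
  assumes "pair_wf_digraph G" "u \<in> pverts G"
  shows "graph_dist G u v \<le> ereal (real p) \<longleftrightarrow> (\<exists>k\<le>p. (u, v) \<in> parcs G ^^ k)"
proof -
  interpret pair_wf_digraph G by fact
  have cost: "awalk_cost (\<lambda>_. 1) q = real (length q)" for q :: "('a \<times> 'a) list"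
    by (induction q) auto
  show ?thesis
  proof
    assume le: "graph_dist G u v \<le> ereal (real p)"
    show "\<exists>k\<le>p. (u, v) \<in> parcs G ^^ k"
    proof (rule ccontr)
      assume no: "\<not> ?thesis"
      \<comment> \<open>Lengths are integers, so without walks of length at most \<open>p\<close>
        all of them are bounded below by \<open>Suc p\<close>. This bound survives the infimum,
        whereas the strict bound by \<open>p\<close> would only give \<open>p\<close>
        itself.\<close>
      have "real (Suc p) \<le> real (length q)" if "awalk u q v" for q
        using no awalk_imp_relpow[OF assms(1) that] by (metis not_less_eq_eq of_nat_le_iff)
      then have "ereal (real (Suc p)) \<le> graph_dist G u v"
        unfolding graph_dist_def \<mu>_def by (intro INF_greatest) (auto simp: cost)
      from order_trans[OF this le] show False by simp
    qed
  next
    assume "\<exists>k\<le>p. (u, v) \<in> parcs G ^^ k"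
    then obtain q where q: "awalk u q v" "length q \<le> p"
      using relpow_imp_awalk[OF assms] by blast
    then have "graph_dist G u v \<le> ereal (real (length q))"
      unfolding graph_dist_def using min_cost_le_walk_cost[OF q(1), of "\<lambda>_. 1"] by (simp add: cost)
    then show "graph_dist G u v \<le> ereal (real p)"
      using q(2) by (meson ereal_less_eq(3) of_nat_le_iff order_trans)
  qed
qed

section \<open>Distances in a product of two stars\<close>

definition star_dist :: "nat \<Rightarrow> nat \<Rightarrow> nat" where
  "star_dist u v = (if u = v then 0 else if u = 0 \<or> v = 0 then 1 else 2)"

lemma star_dist_relpow:
  assumes "u \<in> {0..n}" "v \<in> {0..n}"
  shows "(u, v) \<in> parcs (star_graph n) ^^ star_dist u v"
proof -
  consider "u = v" | "u \<noteq> v" "u = 0 \<or> v = 0" | "u \<noteq> v" "u \<noteq> 0" "v \<noteq> 0" by blast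
  then show ?thesis
  proof cases
    case 3
    then have "(u, 0) \<in> parcs (star_graph n)" "(0, v) \<in> parcs (star_graph n)"
      using assms by (auto simp: star_graph_def)
    with 3 show ?thesis by (auto simp: star_dist_def numeral_2_eq_2)
  qed (use assms in \<open>auto simp: star_dist_def star_graph_def\<close>)
qed

lemma relpow_cartesian_left:
  assumes "pair_wf_digraph G" "v \<in> pverts H" "(u, u') \<in> parcs G ^^ k"
  shows "((u, v), (u', v)) \<in> parcs (G \<box> H) ^^ k"
  using assms(3)
proof (induction k arbitrary: u')
  case (Suc k)
  then obtain w where w: "(u, w) \<in> parcs G ^^ k" "(w, u') \<in> parcs G" by auto
  with assms(2) have "((w, v), (u', v)) \<in> parcs (G \<box> H)"
    using pair_wf_digraph.arc_fst_in_verts[OF assms(1)] pair_wf_digraph.arc_snd_in_verts[OF assms(1)]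
    by (fastforce simp: cartesian_product_def)
  with Suc.IH[OF w(1)] show ?case by auto
qed auto

lemma relpow_cartesian_right:
  assumes "pair_wf_digraph H" "u \<in> pverts G" "(v, v') \<in> parcs H ^^ k"
  shows "((u, v), (u, v')) \<in> parcs (G \<box> H) ^^ k"
  using assms(3)
proof (induction k arbitrary: v')
  case (Suc k)
  then obtain w where w: "(v, w) \<in> parcs H ^^ k" "(w, v') \<in> parcs H" by auto
  with assms(2) have "((u, w), (u, v')) \<in> parcs (G \<box> H)"
    using pair_wf_digraph.arc_fst_in_verts[OF assms(1)] pair_wf_digraph.arc_snd_in_verts[OF assms(1)]
    by (fastforce simp: cartesian_product_def)
  with Suc.IH[OF w(1)] show ?case by auto
qed auto

text \<open>An arc of the product moves one coordinate along one star edge and fixes the other, so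
  the sum of the two star distances from the start grows by at most 1 per arc.\<close>

lemma star_product_relpow_ge:
  assumes "((u, v), (u', v')) \<in> parcs (star_graph n \<box> star_graph m) ^^ k"
  shows "star_dist u u' + star_dist v v' \<le> k"
  using assms
proof (induction k arbitrary: u' v')
  case 0
  then show ?case by (simp add: star_dist_def)
next
  case (Suc k)
  then obtain x y where xy: "((u, v), (x, y)) \<in> parcs (star_graph n \<box> star_graph m) ^^ k"
    "((x, y), (u', v')) \<in> parcs (star_graph n \<box> star_graph m)" by auto
  from xy(2) have "star_dist u u' + star_dist v v' \<le> Suc (star_dist u x + star_dist v y)"
    by (auto simp: cartesian_product_def star_graph_def star_dist_def)
  with Suc.IH[OF xy(1)] show ?case by simp
qed

lemma pair_wf_star_graph: "pair_wf_digraph (star_graph n)"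
  by unfold_locales (auto simp: star_graph_def)

lemma star_product_dist_le_3_iff:
  assumes "u \<in> {0..n}" "u' \<in> {0..n}" "v \<in> {0..m}" "v' \<in> {0..m}"
  shows "graph_dist (star_graph n \<box> star_graph m) (u, v) (u', v') \<le> ereal (real 3) \<longleftrightarrow>
         u = 0 \<or> v = 0 \<or> u' = 0 \<or> v' = 0 \<or> u = u' \<or> v = v'"
proof -
  let ?P = "star_graph n \<box> star_graph m"
  \<comment> \<open>Walking first in the first coordinate and then in the second attains the lower
    bound of \<open>star_product_relpow_ge\<close>.\<close>
  have "((u, v), (u', v)) \<in> parcs ?P ^^ star_dist u u'"
    using assms by (intro relpow_cartesian_left star_dist_relpow pair_wf_star_graph)
      (auto simp: star_graph_def)
  moreover have "((u', v), (u', v')) \<in> parcs ?P ^^ star_dist v v'"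
    using assms by (intro relpow_cartesian_right star_dist_relpow pair_wf_star_graph)
      (auto simp: star_graph_def)
  ultimately have "((u, v), (u', v')) \<in> parcs ?P ^^ (star_dist u u' + star_dist v v')"
    by (auto simp: relpow_add)
  then have "(\<exists>k\<le>3. ((u, v), (u', v')) \<in> parcs ?P ^^ k) \<longleftrightarrow>
      star_dist u u' + star_dist v v' \<le> 3"
    using star_product_relpow_ge order_trans by blast
  \<comment> \<open>Both summands are at most 2, so the sum exceeds 3 only if both equal 2.\<close>
  also have "\<dots> \<longleftrightarrow> u = 0 \<or> v = 0 \<or> u' = 0 \<or> v' = 0 \<or> u = u' \<or> v = v'"
    by (auto simp: star_dist_def)
  finally have iff: "(\<exists>k\<le>3. ((u, v), (u', v')) \<in> parcs ?P ^^ k) \<longleftrightarrow>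
      u = 0 \<or> v = 0 \<or> u' = 0 \<or> v' = 0 \<or> u = u' \<or> v = v'" .
  have "pair_wf_digraph ?P"
    by unfold_locales (auto simp: cartesian_product_def)
  moreover have "(u, v) \<in> pverts ?P"
    using assms by (auto simp: cartesian_product_def star_graph_def)
  ultimately show ?thesis
    by (simp only: graph_dist_le_iff iff)
qed

section \<open>Reduction of the third power to a rook graph\<close>

abbreviation star_power :: "nat \<Rightarrow> (nat \<times> nat) pair_pre_digraph" where
  "star_power n \<equiv> power_graph (star_graph n \<box> star_graph 3) 3"

lemma pverts_star_power: "pverts (star_power n) = {0..n} \<times> {0..3}"
  by (simp add: power_graph_def cartesian_product_def star_graph_def)

lemma parcs_star_power:
  "((u, v), (u', v')) \<in> parcs (star_power n) \<longleftrightarrow>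
     u \<in> {0..n} \<and> v \<in> {0..3} \<and> u' \<in> {0..n} \<and> v' \<in> {0..3} \<and> (u, v) \<noteq> (u', v') \<and>
     (u = 0 \<or> v = 0 \<or> u' = 0 \<or> v' = 0 \<or> u = u' \<or> v = v')"
proof -
  have "((u, v), (u', v')) \<in> parcs (star_power n) \<longleftrightarrow>
     u \<in> {0..n} \<and> v \<in> {0..3} \<and> u' \<in> {0..n} \<and> v' \<in> {0..3} \<and> (u, v) \<noteq> (u', v') \<and>
     graph_dist (star_graph n \<box> star_graph 3) (u, v) (u', v') \<le> ereal (real 3)"
    by (auto simp: power_graph_def cartesian_product_def star_graph_def)
  then show ?thesis using star_product_dist_le_3_iff by blast
qed

text \<open>The union is disjoint: \<open>(0, 0)\<close> is counted only in the first part, which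
  gives 4 + \<open>n\<close> vertices.\<close>

definition universal :: "nat \<Rightarrow> (nat \<times> nat) set" where
  "universal n = {0} \<times> {0..3} \<union> {1..n} \<times> {0}"

lemma card_universal: "card (universal n) = n + 4"
  unfolding universal_def by (subst card_Un_disjoint) (auto simp: card_cartesian_product)

lemma finite_universal: "finite (universal n)"
  by (simp add: universal_def)

lemma universal_subset: "universal n \<subseteq> pverts (star_power n)"
  by (auto simp: universal_def pverts_star_power)

lemma universal_iff: "(i, j) \<in> universal n \<longleftrightarrow> i \<le> n \<and> j \<le> 3 \<and> (i = 0 \<or> j = 0)"
  by (auto simp: universal_def)

text \<open>In \<open>a i j\<close> the indices \<open>i\<close> and \<open>j\<close> stand for the column and the row of a cell in a table with
  three rows.\<close>

definition rook_proper :: "nat \<Rightarrow> (nat \<Rightarrow> nat \<Rightarrow> nat) \<Rightarrow> bool" where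
  "rook_proper n a \<longleftrightarrow>
     (\<forall>j\<in>{1..3}. inj_on (\<lambda>i. a i j) {1..n}) \<and> (\<forall>i\<in>{1..n}. inj_on (a i) {1..3})"

text \<open>The row and the column contain the cell itself, so a cell of the table always sees its
  own colour. This absorbs the exception \<open>j \<noteq> c v\<close> in
  \<open>b_vertex\<close>.\<close>

definition rook_sees :: "nat \<Rightarrow> nat set \<Rightarrow> (nat \<Rightarrow> nat \<Rightarrow> nat) \<Rightarrow> nat \<Rightarrow> nat \<Rightarrow> bool" where
  "rook_sees n C a i j \<longleftrightarrow> C \<subseteq> (\<lambda>i'. a i' j) ` {1..n} \<union> a i ` {1..3}"

text \<open>The colours form an arbitrary set, since those left over by the universal vertices need
  not be an interval.\<close>

definition rook_b_coloring :: "nat \<Rightarrow> nat set \<Rightarrow> (nat \<Rightarrow> nat \<Rightarrow> nat) \<Rightarrow> bool" where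
  "rook_b_coloring n C a \<longleftrightarrow>
     (\<forall>i\<in>{1..n}. \<forall>j\<in>{1..3}. a i j \<in> C) \<and> rook_proper n a \<and>
     (\<forall>x\<in>C. \<exists>i\<in>{1..n}. \<exists>j\<in>{1..3}. a i j = x \<and> rook_sees n C a i j)"

text \<open>The colour of a universal vertex occurs nowhere else, so these vertices use up
  \<open>n + 4\<close> colours. A b-vertex of a remaining colour lies in the table, and it can meet
  the other remaining colours only inside the table, hence in its row or column.\<close>

lemma b_coloring_imp_rook:
  assumes b: "b_coloring (star_power n) k c"
  obtains C where "rook_b_coloring n C (\<lambda>i j. c (i, j))" "k = card C + n + 4"
proof -
  let ?U = "universal n"
  define C where "C = {1..k} - c ` ?U"
  have range: "c (i, j) \<in> {1..k}" if "i \<le> n" "j \<le> 3" for i j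
    using b that by (auto simp: b_coloring_def proper_coloring_def pverts_star_power)
  have proper: "c (i, j) \<noteq> c (i', j')"
    if "i \<le> n" "j \<le> 3" "i' \<le> n" "j' \<le> 3" "(i, j) \<noteq> (i', j')"
      "i = 0 \<or> j = 0 \<or> i' = 0 \<or> j' = 0 \<or> i = i' \<or> j = j'" for i j i' j'
  proof -
    have "((i, j), (i', j')) \<in> parcs (star_power n)"
      using that by (auto simp: parcs_star_power)
    then show ?thesis using b by (fastforce simp: b_coloring_def proper_coloring_def)
  qed
  have "inj_on c ?U"
    by (rule inj_onI) (metis proper universal_iff surj_pair)
  then have "card (c ` ?U) = n + 4" by (simp add: card_image card_universal)
  moreover have sub: "c ` ?U \<subseteq> {1..k}"
    using range by (auto simp: universal_iff simp del: atLeastAtMost_iff)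
  ultimately have "card C = k - (n + 4)" "n + 4 \<le> k"
    using card_mono[OF _ sub] by (simp_all add: C_def card_Diff_subset finite_universal)
  then have card: "k = card C + n + 4" by simp
  have in_C: "c (i, j) \<in> C" if "i \<in> {1..n}" "j \<in> {1..3}" for i j
  proof -
    have "c (i, j) \<notin> c ` ?U"
    proof
      assume "c (i, j) \<in> c ` ?U"
      then obtain i' j' where "(i', j') \<in> ?U" "c (i, j) = c (i', j')" by auto
      with that proper[of i j i' j'] show False by (auto simp: universal_iff)
    qed
    then show ?thesis using that range[of i j] by (simp add: C_def)
  qed
  have outside: "i \<in> {1..n} \<and> j \<in> {1..3}" if "i \<le> n" "j \<le> 3" "c (i, j) \<in> C" for i j
  proof -
    have "(i, j) \<notin> ?U" using that(3) by (auto simp: C_def)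
    with that show ?thesis by (auto simp: universal_iff)
  qed
  have "\<exists>i\<in>{1..n}. \<exists>j\<in>{1..3}. c (i, j) = x \<and> rook_sees n C (\<lambda>i j. c (i, j)) i j"
    if x: "x \<in> C" for x
  proof -
    from x b obtain i j where ij: "i \<le> n" "j \<le> 3" "c (i, j) = x" "b_vertex (star_power n) k c (i, j)"
    proof -
      have "x \<in> {1..k}" using x by (simp add: C_def)
      then obtain v where "v \<in> pverts (star_power n)" "c v = x" "b_vertex (star_power n) k c v"
        using b unfolding b_coloring_def by blast
      then show ?thesis using that by (cases v) (auto simp: pverts_star_power)
    qed
    then have ij': "i \<in> {1..n}" "j \<in> {1..3}" using outside x by auto
    have "y \<in> (\<lambda>i'. c (i', j)) ` {1..n} \<union> (\<lambda>j'. c (i, j')) ` {1..3}" if y: "y \<in> C" for y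
    proof (cases "y = x")
      case True
      then show ?thesis using ij(3) ij' by auto
    next
      case False
      with y ij obtain i' j' where "((i, j), (i', j')) \<in> parcs (star_power n)" "c (i', j') = y"
      proof -
        have "y \<in> {1..k}" using y by (simp add: C_def)
        with False ij(3,4) obtain w where "((i, j), w) \<in> parcs (star_power n)" "c w = y"
          unfolding b_vertex_def by blast
        then show ?thesis using that by (cases w) simp
      qed
      then have "i' \<in> {1..n}" "j' \<in> {1..3}" "i = i' \<or> j = j'" "y = c (i', j')"
        using outside[of i' j'] y ij' by (auto simp: parcs_star_power)
      then show ?thesis by blast
    qed
    then have "rook_sees n C (\<lambda>i j. c (i, j)) i j" unfolding rook_sees_def by (rule subsetI)
    with ij(3) ij' show ?thesis by (intro bexI[of _ i] bexI[of _ j] conjI)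
  qed
  moreover have "rook_proper n (\<lambda>i j. c (i, j))"
    unfolding rook_proper_def
  proof (intro conjI ballI inj_onI)
    fix i i' j assume "j \<in> {1..3::nat}" "i \<in> {1..n}" "i' \<in> {1..n}" "c (i, j) = c (i', j)"
    then show "i = i'" using proper[of i j i' j] by auto
  next
    fix i j j' assume "i \<in> {1..n}" "j \<in> {1..3}" "j' \<in> {1..3}" "c (i, j) = c (i, j')"
    then show "j = j'" using proper[of i j i j'] by auto
  qed
  ultimately have "rook_b_coloring n C (\<lambda>i j. c (i, j))"
    using in_C by (simp add: rook_b_coloring_def)
  then show ?thesis using that card by blast
qed

lemma rook_imp_b_coloring:
  assumes a: "rook_b_coloring n {1..m} a"
  shows "\<exists>c. b_coloring (star_power n) (m + n + 4) c"
proof -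
  \<comment> \<open>The table keeps the colours 1 to \<open>m\<close>; the vertices
    \<open>(0, 0)\<close>, ..., \<open>(0, 3)\<close> get \<open>m + 1\<close> to
    \<open>m + 4\<close>, and \<open>(1, 0)\<close>, ..., \<open>(n, 0)\<close> get
    \<open>m + 5\<close> to \<open>m + n + 4\<close>.\<close>
  define c where "c = (\<lambda>(i, j). if i = 0 then m + 1 + j else if j = 0 then m + 4 + i else a i j)"
  have range: "a i j \<in> {1..m}" if "i \<in> {1..n}" "j \<in> {1..3}" for i j
    using a that by (simp add: rook_b_coloring_def)
  have inj: "\<And>j. j \<in> {1..3} \<Longrightarrow> inj_on (\<lambda>i. a i j) {1..n}" "\<And>i. i \<in> {1..n} \<Longrightarrow> inj_on (a i) {1..3}"
    using a by (auto simp: rook_b_coloring_def rook_proper_def)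
  have "proper_coloring (star_power n) (m + n + 4) c"
    unfolding proper_coloring_def
  proof (intro conjI ballI; clarify)
    fix i j assume "(i, j) \<in> pverts (star_power n)"
    then show "c (i, j) \<in> {1..m + n + 4}"
      using range[of i j] by (force simp: c_def pverts_star_power)
  next
    fix i j i' j' assume "((i, j), (i', j')) \<in> parcs (star_power n)" "c (i, j) = c (i', j')"
    then show False
      using range[of i j] range[of i' j'] inj_onD[OF inj(1), of j i i'] inj_onD[OF inj(2), of i j j']
      by (auto simp: c_def parcs_star_power split: if_splits)
  qed
  moreover have "\<exists>v\<in>pverts (star_power n). c v = x \<and> b_vertex (star_power n) (m + n + 4) c v"
    if x: "x \<in> {1..m + n + 4}" for x
  proof -
    have surj_U: "\<exists>v\<in>universal n. c v = y" if "y \<in> {m + 1..m + n + 4}" for y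
    proof (cases "y \<le> m + 4")
      case True
      with that show ?thesis
        by (intro bexI[of _ "(0, y - (m + 1))"]) (auto simp: c_def universal_def)
    next
      case False
      with that show ?thesis
        by (intro bexI[of _ "(y - (m + 4), 0)"]) (auto simp: c_def universal_def)
    qed
    have surj: "\<exists>v\<in>pverts (star_power n). c v = y" if "y \<in> {1..m + n + 4}" for y
    proof (cases "y \<le> m")
      case True
      with that have "y \<in> {1..m}" by simp
      then obtain i j where "i \<in> {1..n}" "j \<in> {1..3}" "a i j = y"
        using a unfolding rook_b_coloring_def by blast
      then show ?thesis by (intro bexI[of _ "(i, j)"]) (auto simp: c_def pverts_star_power)
    next
      case False
      with that have "y \<in> {m + 1..m + n + 4}" by simp
      from surj_U[OF this] obtain v where "v \<in> universal n" "c v = y" by (elim bexE)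
      then show ?thesis using subsetD[OF universal_subset, of v n] by (intro bexI[of _ v])
    qed
    show ?thesis
    proof (cases "x \<le> m")
      case True
      with x have "x \<in> {1..m}" by simp
      then obtain i j where ij: "i \<in> {1..n}" "j \<in> {1..3}" "a i j = x" "rook_sees n {1..m} a i j"
        using a unfolding rook_b_coloring_def by blast
      have cij: "c (i, j) = x" using ij by (auto simp: c_def)
      have "\<exists>w\<in>pverts (star_power n). ((i, j), w) \<in> parcs (star_power n) \<and> c w = y"
        if y: "y \<in> {1..m + n + 4}" "y \<noteq> x" for y
      proof (cases "y \<le> m")
        case True
        with y have "y \<in> {1..m}" by simp
        with ij(4) have "y \<in> (\<lambda>i'. a i' j) ` {1..n} \<union> a i ` {1..3}"
          unfolding rook_sees_def by blast
        then consider i' where "i' \<in> {1..n}" "y = a i' j" | j' where "j' \<in> {1..3}" "y = a i j'"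
          by blast
        then show ?thesis
        proof cases
          case 1
          then show ?thesis using y(2) ij
            by (intro bexI[of _ "(i', j)"]) (auto simp: c_def pverts_star_power parcs_star_power)
        next
          case 2
          then show ?thesis using y(2) ij
            by (intro bexI[of _ "(i, j')"]) (auto simp: c_def pverts_star_power parcs_star_power)
        qed
      next
        case False
        with y have "y \<in> {m + 1..m + n + 4}" by simp
        from surj_U[OF this] obtain w where w: "w \<in> universal n" "c w = y" by (elim bexE)
        moreover have "(i, j) \<noteq> w" using cij w(2) y(2) by auto
        then have "((i, j), w) \<in> parcs (star_power n)"
          using w(1) ij(1,2) by (cases w) (auto simp: universal_iff parcs_star_power)
        ultimately show ?thesis using subsetD[OF universal_subset, of w n] by (intro bexI[of _ w] conjI)
      qed
      then have "b_vertex (star_power n) (m + n + 4) c (i, j)"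
        using ij(1,2) unfolding b_vertex_def cij by (auto simp: pverts_star_power)
      then show ?thesis using ij(1,2) cij
        by (intro bexI[of _ "(i, j)"] conjI) (auto simp: pverts_star_power)
    next
      case False
      with x have "x \<in> {m + 1..m + n + 4}" by simp
      then obtain v where v: "v \<in> universal n" "c v = x" using surj_U by blast
      \<comment> \<open>A universal vertex is adjacent to all others, so it is a b-vertex as soon as
        every colour occurs.\<close>
      have "(v, w) \<in> parcs (star_power n)" if "w \<in> pverts (star_power n)" "w \<noteq> v" for w
        using v(1) that by (cases v; cases w) (auto simp: universal_iff pverts_star_power parcs_star_power)
      moreover have vG: "v \<in> pverts (star_power n)" using subsetD[OF universal_subset v(1)] .
      ultimately have "b_vertex (star_power n) (m + n + 4) c v"
        using surj unfolding b_vertex_def by metis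
      then show ?thesis using v(2) vG by (intro bexI[of _ v] conjI)
    qed
  qed
  ultimately show ?thesis by (auto simp: b_coloring_def)
qed

section \<open>Upper bounds for the number of colours of the table\<close>

lemma rook_b_coloring_bounds:
  assumes a: "rook_b_coloring n C a"
  shows "card C \<le> n + 2" "n < card C \<Longrightarrow> card C \<le> 6" "2 \<le> n \<Longrightarrow> card C \<noteq> n + 2"
proof -
  \<comment> \<open>\<open>row j\<close> collects the colours of row \<open>j\<close>, and
    \<open>B j\<close> the columns in which row \<open>j\<close> has a cell seeing all
    colours.\<close>
  define row where "row j = (\<lambda>i. a i j) ` {1..n}" for j
  define B where "B j = {i \<in> {1..n}. rook_sees n C a i j}" for j
  have in_C: "\<And>i j. i \<in> {1..n} \<Longrightarrow> j \<in> {1..3} \<Longrightarrow> a i j \<in> C"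
    using a by (simp add: rook_b_coloring_def)
  have inj_row: "\<And>j. j \<in> {1..3} \<Longrightarrow> inj_on (\<lambda>i. a i j) {1..n}"
    and inj_col: "\<And>i. i \<in> {1..n} \<Longrightarrow> inj_on (a i) {1..3}"
    using a by (auto simp: rook_b_coloring_def rook_proper_def)
  have finB: "finite (B j)" for j by (simp add: B_def)
  have card_missing: "card (C - row j) = card C - n" if "j \<in> {1..3}" for j
  proof -
    have "row j \<subseteq> C" "finite (row j)" using in_C that by (auto simp: row_def)
    moreover have "card (row j) = n" unfolding row_def using card_image[OF inj_row[OF that]] by simp
    ultimately show ?thesis by (simp add: card_Diff_subset)
  qed
  \<comment> \<open>What the row lacks must come from the two other cells of the column.\<close>
  have sees: "C - row j \<subseteq> a i ` ({1..3} - {j})" if "i \<in> B j" for i j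
  proof
    fix x assume x: "x \<in> C - row j"
    with that obtain j' where "j' \<in> {1..3}" "x = a i j'"
      unfolding B_def rook_sees_def row_def by blast
    moreover have "a i j \<in> row j" using that by (simp add: B_def row_def)
    ultimately show "x \<in> a i ` ({1..3} - {j})" using x by blast
  qed
  have C_sub: "C \<subseteq> (\<Union>j\<in>{1..3}. (\<lambda>i. a i j) ` B j)"
    using a by (fastforce simp: rook_b_coloring_def B_def)
  have card_C: "card C \<le> card (B 1) + card (B 2) + card (B 3)"
  proof -
    have "card C \<le> card (\<Union>j\<in>{1..3}. (\<lambda>i. a i j) ` B j)"
      using C_sub finB by (intro card_mono) auto
    also have "\<dots> \<le> (\<Sum>j\<in>{1..3}. card ((\<lambda>i. a i j) ` B j))"
      by (rule card_UN_le) simp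
    also have "\<dots> \<le> (\<Sum>j\<in>{1..3}. card (B j))"
      by (intro sum_mono card_image_le finB)
    finally show ?thesis by (simp add: numeral_3_eq_3 numeral_2_eq_2)
  qed
  show le: "card C \<le> n + 2"
  proof (cases "C = {}")
    case False
    then obtain i j where ij: "j \<in> {1..3}" "i \<in> B j" using C_sub by blast
    have "card (C - row j) \<le> card (a i ` ({1..3} - {j}))"
      using sees[OF ij(2)] by (intro card_mono) auto
    also have "\<dots> \<le> card ({1..3} - {j})" by (rule card_image_le) simp
    also have "\<dots> = 2" using ij(1) by simp
    finally show ?thesis using card_missing[OF ij(1)] by simp
  qed simp
  \<comment> \<open>Fix a colour \<open>x\<close> missing from row \<open>j\<close>, and let
    \<open>f\<close> send a column of \<open>B j\<close> to the row in which that column shows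
    \<open>x\<close>. Two columns with the same value would repeat \<open>x\<close> in that row, so
    \<open>f\<close> is injective into the two other rows.\<close>
  have B_le: "card (B j) \<le> 2" if gt: "n < card C" and j: "j \<in> {1..3}" for j
  proof -
    have "C - row j \<noteq> {}" using card_missing[OF j] gt by force
    then obtain x where x: "x \<in> C - row j" by blast
    have "\<exists>j'\<in>{1..3} - {j}. a i j' = x" if "i \<in> B j" for i
      using sees[OF that] x by force
    then obtain f where f: "\<And>i. i \<in> B j \<Longrightarrow> f i \<in> {1..3} - {j} \<and> a i (f i) = x" by metis
    have "inj_on f (B j)"
      by (rule inj_onI) (metis (no_types, lifting) B_def Diff_iff f inj_onD inj_row mem_Collect_eq)
    then have "card (B j) \<le> card ({1..3} - {j})"
      using f by (intro card_inj_on_le[of f]) auto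
    then show ?thesis using j by simp
  qed
  show "card C \<le> 6" if "n < card C"
    using card_C B_le[OF that, of 1] B_le[OF that, of 2] B_le[OF that, of 3] by simp
  show "card C \<noteq> n + 2" if n2: "2 \<le> n"
  proof
    assume eq: "card C = n + 2"
    \<comment> \<open>A row with two b-cells misses two colours, and these occupy the remaining cells of both
      columns, in opposite orders.\<close>
    have excl: "i \<notin> B j'" if j: "j \<in> {1..3}" "j' \<in> {1..3}" "j \<noteq> j'"
      and i: "i \<in> B j" "i' \<in> B j" "i \<noteq> i'" for i i' j j'
    proof
      assume iB: "i \<in> B j'"
      have iv: "i \<in> {1..n}" "i' \<in> {1..n}" using i by (auto simp: B_def)
      \<comment> \<open>\<open>k\<close> is the third row, as the three row indices add up to
        6.\<close>
      define k where "k = 6 - j - j'"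
      have k: "{1..3} - {j} = {j', k}" "{1..3} - {j'} = {j, k}" "k \<in> {1..3}" "k \<noteq> j'" "k \<noteq> j"
      proof -
        have *: "{1..3} = {1, 2, 3 :: nat}" by auto
        have "j = 1 \<and> j' = 2 \<and> k = 3 \<or> j = 1 \<and> j' = 3 \<and> k = 2 \<or> j = 2 \<and> j' = 1 \<and> k = 3 \<or>
            j = 2 \<and> j' = 3 \<and> k = 1 \<or> j = 3 \<and> j' = 1 \<and> k = 2 \<or> j = 3 \<and> j' = 2 \<and> k = 1"
          using j unfolding k_def * by force
        then have "{1..3} - {j} = {j', k} \<and> {1..3} - {j'} = {j, k} \<and> k \<in> {1..3} \<and> k \<noteq> j' \<and> k \<noteq> j"
          unfolding * by (elim disjE conjE; hypsubst; simp add: insert_Diff_if insert_commute)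
        then show "{1..3} - {j} = {j', k}" "{1..3} - {j'} = {j, k}" "k \<in> {1..3}" "k \<noteq> j'" "k \<noteq> j"
          by simp_all
      qed
      \<comment> \<open>With \<open>n + 2\<close> colours exactly two are missing from a row, and
        only two cells of the column can hold them, so the inclusion in \<open>sees\<close> is an
        equality.\<close>
      have full: "C - row l = {a p q, a p r}"
        if "l \<in> {1..3}" "p \<in> B l" "{1..3} - {l} = {q, r}" for l p q r
      proof (rule card_subset_eq)
        show "C - row l \<subseteq> {a p q, a p r}" using sees[OF that(2)] that(3) by simp
        then have "card (C - row l) \<le> card {a p q, a p r}" by (intro card_mono) auto
        moreover have "card {a p q, a p r} \<le> 2" by (simp add: card_insert_if)
        ultimately show "card (C - row l) = card {a p q, a p r}"
          using card_missing[OF that(1)] eq by simp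
      qed simp
      \<comment> \<open>The columns \<open>i\<close> and \<open>i'\<close> carry the same two
        colours in rows \<open>j'\<close> and \<open>k\<close>, and they differ in row
        \<open>j'\<close>; hence the order is reversed. So the colour of \<open>a i k\<close> occurs
        in row \<open>j'\<close>, although a b-cell at column \<open>i\<close> of row
        \<open>j'\<close> would make it a missing colour of that row.\<close>
      have "{a i j', a i k} = {a i' j', a i' k}"
        using full[OF j(1) i(1) k(1)] full[OF j(1) i(2) k(1)] by simp
      moreover have "a i j' \<noteq> a i' j'" using inj_onD[OF inj_row[OF j(2)]] iv i(3) by blast
      ultimately have "a i k = a i' j'" by (simp add: doubleton_eq_iff)
      then have "a i k \<in> row j'" using iv by (auto simp: row_def)
      moreover have "a i k \<in> C - row j'" using full[OF j(2) iB k(2)] by simp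
      ultimately show False by simp
    qed
    have disj: "B j \<inter> B j' = {}"
      if "card (B j) = 2" "j \<in> {1..3}" "j' \<in> {1..3}" "j \<noteq> j'" for j j'
    proof -
      from that(1) obtain p q where "B j = {p, q}" "p \<noteq> q" by (meson card_2_iff)
      then show ?thesis using excl[OF that(2-4), of p q] excl[OF that(2-4), of q p] by auto
    qed
    have add_le: "card (B j) + card (B j') \<le> n"
      if "card (B j) = 2" "j \<in> {1..3}" "j' \<in> {1..3}" "j \<noteq> j'" for j j'
    proof -
      have "card (B j \<union> B j') \<le> card {1..n}" by (intro card_mono) (auto simp: B_def)
      then show ?thesis using card_Un_disjoint[OF finB finB disj[OF that]] by simp
    qed
    have B2: "card (B j) \<le> 2" if "j \<in> {1..3}" for j using B_le[OF _ that] eq by simp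
    have all: "\<not> (card (B 1) = 2 \<and> card (B 2) = 2 \<and> card (B 3) = 2 \<and> n < 6)"
    proof
      assume *: "card (B 1) = 2 \<and> card (B 2) = 2 \<and> card (B 3) = 2 \<and> n < 6"
      have "B 1 \<inter> B 2 = {}" "(B 1 \<union> B 2) \<inter> B 3 = {}"
        using disj[of 1 2] disj[of 1 3] disj[of 2 3] * by auto
      then have "card (B 1 \<union> B 2 \<union> B 3) = 6" using * finB by (simp add: card_Un_disjoint)
      moreover have "card (B 1 \<union> B 2 \<union> B 3) \<le> card {1..n}"
        by (intro card_mono) (auto simp: B_def)
      ultimately show False using * by simp
    qed
    \<comment> \<open>The sum of the three sizes is at least \<open>n + 2\<close> and at most 6, so
      \<open>n\<close> is at most 4. For \<open>n\<close> = 4 all sizes are 2, against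
      \<open>all\<close>; for \<open>n\<close> = 3 two of them are 2, which takes four columns by
      \<open>add_le\<close>; for \<open>n\<close> = 2 some size is 2, which by \<open>add_le\<close>
      forces the others to be 0.\<close>
    show False
      using all card_C eq n2 B2[of 1] B2[of 2] B2[of 3] add_le[of 1 2] add_le[of 1 3]
        add_le[of 2 1] add_le[of 2 3] add_le[of 3 1] add_le[of 3 2]
      by simp linarith
  qed
qed

text \<open>Naming the colours after the first row plays the role of a symmetry reduction.\<close>

lemma four_colored_3_3_table:
  fixes x y z w :: 'a
  assumes "distinct [x,y,z,w]"
    and "b1 \<in> {x,y,z,w}" "b2 \<in> {x,y,z,w}" "b3 \<in> {x,y,z,w}"
    "c1 \<in> {x,y,z,w}" "c2 \<in> {x,y,z,w}" "c3 \<in> {x,y,z,w}"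
    and "distinct [b1,b2,b3]" "distinct [c1,c2,c3]"
    and "distinct [x,b1,c1]" "distinct [y,b2,c2]" "distinct [z,b3,c3]"
    and b: "\<forall>v\<in>{x,y,z,w}.
      v = x \<and> {x, y, z, w} \<subseteq> {x, y, z} \<union> {x, b1, c1} \<or>
      v = y \<and> {x, y, z, w} \<subseteq> {x, y, z} \<union> {y, b2, c2} \<or>
      v = z \<and> {x, y, z, w} \<subseteq> {x, y, z} \<union> {z, b3, c3} \<or>
      v = b1 \<and> {x, y, z, w} \<subseteq> {b1, b2, b3} \<union> {x, b1, c1} \<or>
      v = b2 \<and> {x, y, z, w} \<subseteq> {b1, b2, b3} \<union> {y, b2, c2} \<or>
      v = b3 \<and> {x, y, z, w} \<subseteq> {b1, b2, b3} \<union> {z, b3, c3} \<or>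
      v = c1 \<and> {x, y, z, w} \<subseteq> {c1, c2, c3} \<union> {x, b1, c1} \<or>
      v = c2 \<and> {x, y, z, w} \<subseteq> {c1, c2, c3} \<union> {y, b2, c2} \<or>
      v = c3 \<and> {x, y, z, w} \<subseteq> {c1, c2, c3} \<union> {z, b3, c3}"
  shows False
proof -
  have r: "b1 = y \<or> b1 = z \<or> b1 = w" "b2 = x \<or> b2 = z \<or> b2 = w" "b3 = x \<or> b3 = y \<or> b3 = w"
    "c1 = y \<or> c1 = z \<or> c1 = w" "c2 = x \<or> c2 = z \<or> c2 = w" "c3 = x \<or> c3 = y \<or> c3 = w"
    using assms(1-12) by auto
  have d: "x \<noteq> y" "x \<noteq> z" "x \<noteq> w" "y \<noteq> z" "y \<noteq> w" "z \<noteq> w"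
    "y \<noteq> x" "z \<noteq> x" "w \<noteq> x" "z \<noteq> y" "w \<noteq> y" "w \<noteq> z"
    using assms(1) by auto
  have e: "b1\<noteq>b2" "b1\<noteq>b3" "b2\<noteq>b3" "c1\<noteq>c2" "c1\<noteq>c3" "c2\<noteq>c3" "b1\<noteq>c1" "b2\<noteq>c2" "b3\<noteq>c3"
    using assms(1-12) by auto
  \<comment> \<open>Rows two and three are filled by branching, with improper fillings discarded
    along the way; each surviving table contradicts \<open>b\<close>.\<close>
  show False
    using r(1) r(2) r(3)
    by (elim disjE; (use d e in \<open>simp; fail\<close>)?;
        use r(4) in \<open>elim disjE\<close>; (use d e in \<open>simp; fail\<close>)?;
        use r(5) in \<open>elim disjE\<close>; (use d e in \<open>simp; fail\<close>)?;
        use r(6) in \<open>elim disjE\<close>; (use d e in \<open>simp; fail\<close>)?;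
        use b d in \<open>simp; fail\<close>)
qed

lemma atLeastAtMost_explicit:
  "{1..2} = {1, 2 :: nat}" "{1..3} = {1, 2, 3 :: nat}" "{1..4} = {1, 2, 3, 4 :: nat}"
  "{1..5} = {1, 2, 3, 4, 5 :: nat}" "{1..6} = {1, 2, 3, 4, 5, 6 :: nat}"
  by auto

lemma rook_3_card_neq_4:
  assumes a: "rook_b_coloring 3 C a"
  shows "card C \<noteq> 4"
proof
  assume C4: "card C = 4"
  note e3 = atLeastAtMost_explicit(2)
  have cells: "a i j \<in> C" if "i \<in> {1, 2, 3}" "j \<in> {1, 2, 3}" for i j
    using a that by (simp only: rook_b_coloring_def e3)
  have inj: "\<forall>j\<in>{1, 2, 3}. inj_on (\<lambda>i. a i j) {1, 2, 3}" "\<forall>i\<in>{1, 2, 3}. inj_on (a i) {1, 2, 3}"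
    using a unfolding rook_b_coloring_def rook_proper_def e3 by blast+
  have rows: "distinct [a 1 j, a 2 j, a 3 j]" if "j \<in> {1, 2, 3}" for j
    using bspec[OF inj(1) that] by (simp add: inj_on_def)
  have cols: "distinct [a i 1, a i 2, a i 3]" if "i \<in> {1, 2, 3}" for i
    using bspec[OF inj(2) that] by (simp add: inj_on_def)
  \<comment> \<open>The first row shows three distinct colours, so exactly one colour
    \<open>w\<close> is absent from it.\<close>
  have "card (C - {a 1 1, a 2 1, a 3 1}) = 1"
    using C4 rows[of 1] cells by (subst card_Diff_subset) auto
  then obtain w where w: "C - {a 1 1, a 2 1, a 3 1} = {w}" by (auto simp: card_1_singleton_iff)
  then have C: "C = {a 1 1, a 2 1, a 3 1, w}" using cells[of _ 1] by auto
  have "\<forall>v\<in>C. \<exists>i\<in>{1, 2, 3}. \<exists>j\<in>{1, 2, 3}.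
      a i j = v \<and> C \<subseteq> {a 1 j, a 2 j, a 3 j} \<union> {a i 1, a i 2, a i 3}"
    using a unfolding rook_b_coloring_def rook_sees_def e3 by simp
  \<comment> \<open>With the row quantified outside the column, unfolding the quantifiers lists the
    nine cells in the order of \<open>four_colored_3_3_table\<close>.\<close>
  then have seen: "\<forall>v\<in>C. \<exists>j\<in>{1, 2, 3}. \<exists>i\<in>{1, 2, 3}.
      v = a i j \<and> C \<subseteq> {a 1 j, a 2 j, a 3 j} \<union> {a i 1, a i 2, a i 3}"
    by metis
  show False
  proof (rule four_colored_3_3_table)
    show "distinct [a 1 1, a 2 1, a 3 1, w]" using rows[of 1] w by auto
    show "a 1 2 \<in> {a 1 1, a 2 1, a 3 1, w}" "a 2 2 \<in> {a 1 1, a 2 1, a 3 1, w}"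
      "a 3 2 \<in> {a 1 1, a 2 1, a 3 1, w}" "a 1 3 \<in> {a 1 1, a 2 1, a 3 1, w}"
      "a 2 3 \<in> {a 1 1, a 2 1, a 3 1, w}" "a 3 3 \<in> {a 1 1, a 2 1, a 3 1, w}"
      unfolding C[symmetric] by (auto intro: cells)
    show "distinct [a 1 2, a 2 2, a 3 2]" "distinct [a 1 3, a 2 3, a 3 3]"
      by (rule rows, simp)+
    show "distinct [a 1 1, a 1 2, a 1 3]" "distinct [a 2 1, a 2 2, a 2 3]"
      "distinct [a 3 1, a 3 2, a 3 3]"
      by (rule cols, simp)+
  next
    show "\<forall>v\<in>{a 1 1, a 2 1, a 3 1, w}.
      v = a 1 1 \<and> {a 1 1, a 2 1, a 3 1, w} \<subseteq> {a 1 1, a 2 1, a 3 1} \<union> {a 1 1, a 1 2, a 1 3} \<or>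
      v = a 2 1 \<and> {a 1 1, a 2 1, a 3 1, w} \<subseteq> {a 1 1, a 2 1, a 3 1} \<union> {a 2 1, a 2 2, a 2 3} \<or>
      v = a 3 1 \<and> {a 1 1, a 2 1, a 3 1, w} \<subseteq> {a 1 1, a 2 1, a 3 1} \<union> {a 3 1, a 3 2, a 3 3} \<or>
      v = a 1 2 \<and> {a 1 1, a 2 1, a 3 1, w} \<subseteq> {a 1 2, a 2 2, a 3 2} \<union> {a 1 1, a 1 2, a 1 3} \<or>
      v = a 2 2 \<and> {a 1 1, a 2 1, a 3 1, w} \<subseteq> {a 1 2, a 2 2, a 3 2} \<union> {a 2 1, a 2 2, a 2 3} \<or>
      v = a 3 2 \<and> {a 1 1, a 2 1, a 3 1, w} \<subseteq> {a 1 2, a 2 2, a 3 2} \<union> {a 3 1, a 3 2, a 3 3} \<or>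
      v = a 1 3 \<and> {a 1 1, a 2 1, a 3 1, w} \<subseteq> {a 1 3, a 2 3, a 3 3} \<union> {a 1 1, a 1 2, a 1 3} \<or>
      v = a 2 3 \<and> {a 1 1, a 2 1, a 3 1, w} \<subseteq> {a 1 3, a 2 3, a 3 3} \<union> {a 2 1, a 2 2, a 2 3} \<or>
      v = a 3 3 \<and> {a 1 1, a 2 1, a 3 1, w} \<subseteq> {a 1 3, a 2 3, a 3 3} \<union> {a 3 1, a 3 2, a 3 3}"
      using seen unfolding C[symmetric] by (simp only: bex_simps disj_assoc simp_thms)
  qed
qed

section \<open>Colourings that attain the bounds\<close>

text \<open>The inequalities bound the difference of \<open>p\<close> and \<open>q\<close> strictly
  by \<open>n\<close>, and \<open>n\<close> divides this difference.\<close>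

lemma mod_nat_inj:
  fixes p q n :: nat
  assumes "p mod n = q mod n" "p < q + n" "q < p + n"
  shows "p = q"
proof -
  have "p' = q'" if "p' \<le> q'" "p' mod n = q' mod n" "q' < p' + n" for p' q' :: nat
  proof -
    have "n dvd q' - p'" using that by (metis mod_eq_dvd_iff_nat)
    then show ?thesis using that dvd_imp_le[of n "q' - p'"] by (cases "q' - p' = 0") auto
  qed
  from this[of p q] this[of q p] show ?thesis using assms by (cases "p \<le> q") auto
qed

text \<open>Every row is a cyclic shift of all \<open>n\<close> colours, so every cell sees all of
  them within its row. A column holds three consecutive residues, which are distinct because
  \<open>n\<close> is at least 3.\<close>

lemma cyclic_rook_b_coloring:
  assumes n: "3 \<le> n"
  shows "rook_b_coloring n {1..n} (\<lambda>i j. (i + j) mod n + 1)"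
proof -
  let ?a = "\<lambda>i j. (i + j) mod n + 1"
  have inj: "inj_on (\<lambda>i. ?a i j) {1..n}" for j
  proof (rule inj_onI)
    fix x y assume "x \<in> {1..n}" "y \<in> {1..n}" "?a x j = ?a y j"
    then show "x = y" using mod_nat_inj[of "x + j" n "y + j"] by auto
  qed
  have inj': "inj_on (?a i) {1..3}" for i
  proof (rule inj_onI)
    fix x y :: nat assume "x \<in> {1..3}" "y \<in> {1..3}" "?a i x = ?a i y"
    then show "x = y" using mod_nat_inj[of "i + x" n "i + y"] n by auto
  qed
  have in_range: "?a i j \<in> {1..n}" for i j
    using n mod_less_divisor[of n "i + j"] by (simp add: Suc_le_eq)
  have row: "(\<lambda>i. ?a i j) ` {1..n} = {1..n}" for j
  proof (rule card_subset_eq)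
    show "(\<lambda>i. ?a i j) ` {1..n} \<subseteq> {1..n}" using in_range by blast
    show "card ((\<lambda>i. ?a i j) ` {1..n}) = card {1..n}" by (rule card_image[OF inj])
  qed simp
  have sees: "rook_sees n {1..n} ?a i j" for i j
    using row[of j] unfolding rook_sees_def by blast
  have ex: "\<exists>i\<in>{1..n}. \<exists>j\<in>{1..3}. ?a i j = x \<and> rook_sees n {1..n} ?a i j" if "x \<in> {1..n}" for x
  proof -
    have "x \<in> (\<lambda>i. ?a i 1) ` {1..n}" using that by (simp only: row)
    then obtain i where "i \<in> {1..n}" "?a i 1 = x" by blast
    then show ?thesis using sees by (intro bexI[of _ i] bexI[of _ 1] conjI) auto
  qed
  show ?thesis
    unfolding rook_b_coloring_def rook_proper_def using inj inj' in_range ex by blast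
qed

lemma rook_b_coloring_table_1: "rook_b_coloring 1 {1..3} (\<lambda>i j. j)"
  unfolding rook_b_coloring_def rook_proper_def rook_sees_def by auto

text \<open>Here and below the inner lists are the columns. In this table each column already shows
  all three colours.\<close>

lemma rook_b_coloring_table_2: "rook_b_coloring 2 {1..3} (\<lambda>i j. [[1, 2, 3], [2, 3, 1]] ! (i - 1) ! (j - 1))"
  unfolding rook_b_coloring_def rook_proper_def rook_sees_def atLeastAtMost_explicit
  by (simp add: inj_on_def)

text \<open>The rows miss the colours 5, 4, 2 in turn. The columns containing the missing colour
  give b-cells of colours 2, 4 in the first row, 1, 5 in the second and 3, 5 in the third.\<close>

lemma rook_b_coloring_table_4:
  "rook_b_coloring 4 {1..5} (\<lambda>i j. [[1, 2, 3], [2, 3, 5], [3, 1, 4], [4, 5, 1]] ! (i - 1) ! (j - 1))"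
  unfolding rook_b_coloring_def rook_proper_def rook_sees_def atLeastAtMost_explicit
  by (simp add: inj_on_def)

text \<open>The rows miss 6, 3, 4 in turn, and their b-cells have colours 3, 5, then 2, 4, then 6,
  1. This is the extremal case: two b-cells per row, and each colour has exactly one.\<close>

lemma rook_b_coloring_table_5:
  "rook_b_coloring 5 {1..6}
     (\<lambda>i j. [[1, 2, 3], [2, 1, 5], [3, 4, 6], [4, 5, 1], [5, 6, 2]] ! (i - 1) ! (j - 1))"
  unfolding rook_b_coloring_def rook_proper_def rook_sees_def atLeastAtMost_explicit
  by (simp add: inj_on_def)

section \<open>The values of the b-chromatic number\<close>

lemma b_chromatic_star_power:
  assumes "rook_b_coloring n {1..m} a"
    and "\<And>C a. rook_b_coloring n C a \<Longrightarrow> card C \<le> m"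
  shows "\<phi> (star_power n) = m + n + 4"
  unfolding b_chromatic_number_def
proof (rule Greatest_equality)
  show "\<exists>c. b_coloring (star_power n) (m + n + 4) c"
    using rook_imp_b_coloring[OF assms(1)] .
next
  fix k assume "\<exists>c. b_coloring (star_power n) k c"
  then show "k \<le> m + n + 4"
    using assms(2) by (metis b_coloring_imp_rook add_le_mono1)
qed

theorem theorem4p3:
  shows "\<phi> (power_graph (star_graph 1 \<box> star_graph 3) 3) = 8
       \<and> \<phi> (power_graph (star_graph 2 \<box> star_graph 3) 3) = 9
       \<and> \<phi> (power_graph (star_graph 3 \<box> star_graph 3) 3) = 10
       \<and> \<phi> (power_graph (star_graph 4 \<box> star_graph 3) 3) = 13
       \<and> \<phi> (power_graph (star_graph 5 \<box> star_graph 3) 3) = 15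
       \<and> (\<forall>n \<ge> 6. \<phi> (power_graph (star_graph n \<box> star_graph 3) 3) = 2 * n + 4)"
proof (intro conjI allI impI)
  show "\<phi> (star_power 1) = 8"
    using b_chromatic_star_power[OF rook_b_coloring_table_1] rook_b_coloring_bounds(1)[of 1]
    by fastforce
  show "\<phi> (star_power 2) = 9"
  proof -
    have "card C \<le> 3" if "rook_b_coloring 2 C a" for C a
      using rook_b_coloring_bounds(1,3)[OF that] by simp
    from b_chromatic_star_power[OF rook_b_coloring_table_2 this] show ?thesis by simp
  qed
  show "\<phi> (star_power 3) = 10"
  proof -
    \<comment> \<open>The degree bound leaves 5 and 4 to exclude: 5 is \<open>n + 2\<close>, and 4
      falls to the case analysis.\<close>
    have "card C \<le> 3" if "rook_b_coloring 3 C a" for C a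
      using rook_b_coloring_bounds(1,3)[OF that] rook_3_card_neq_4[OF that] by simp
    from b_chromatic_star_power[OF cyclic_rook_b_coloring this] show ?thesis by simp
  qed
  show "\<phi> (star_power 4) = 13"
  proof -
    have "card C \<le> 5" if "rook_b_coloring 4 C a" for C a
      using rook_b_coloring_bounds(1,3)[OF that] by simp
    from b_chromatic_star_power[OF rook_b_coloring_table_4 this] show ?thesis by simp
  qed
  show "\<phi> (star_power 5) = 15"
  proof -
    have "card C \<le> 6" if "rook_b_coloring 5 C a" for C a
      using rook_b_coloring_bounds(2)[OF that] by (cases "5 < card C") simp_all
    from b_chromatic_star_power[OF rook_b_coloring_table_5 this] show ?thesis by simp
  qed
  fix n :: nat assume n: "6 \<le> n"
  \<comment> \<open>More than \<open>n\<close> colours would force at most 6 colours, which is at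
    most \<open>n\<close>.\<close>
  have "card C \<le> n" if "rook_b_coloring n C a" for C a
    using rook_b_coloring_bounds(2)[OF that] n by (cases "n < card C") simp_all
  from b_chromatic_star_power[OF cyclic_rook_b_coloring this] n
  show "\<phi> (star_power n) = 2 * n + 4" by simp
qed

end
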